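(* Let $f:\mathbb{R}^{n_x}\to\mathbb{R}^{n_x}$, $\psi:\mathbb{R}^{n_x}\to\mathbb{R}$, a restitution law $\Gamma:S^-\to S^+$ and an auxiliary vector field $\varphi:\mathbb{R}^{n_x}\to\mathbb{R}^{n_x}$ be given, with the sets $V^+,V^-,S,S^-,S^+$ as defined in the context, and suppose that the Auxiliary Dynamics Assumption stated in the context holds for $\varphi$. Let $x_0\in V^+$, let $y_0=(x_0,0)\in\mathbb{R}^{n_x+1}$, and let $\tau_{\mathrm f}>0$. Let $y(\tau;y_0)=(\tilde x(\tau),t(\tau))$ be the solution, on the pseudo-time interval $(0,\tau_{\mathrm f})$, of the initial value problem for the time-frozen differential equation (context) with initial value $y_0$, and assume $\tilde x(\tau_{\mathrm f})\in V^+$. Put $t_{\mathrm f}:=t(\tau_{\mathrm f})$ and let $x(t;x_0)$ be the solution, on the time interval $(0,t_{\mathrm f})$, of the initial value problem for the ordinary differential equation with state jumps (context) with initial value $x_0$. Suppose that there is at most one time point $t_s\in(0,t_{\mathrm f})$ at which $\psi(x(t_s))=0$. Then the two solutions satisfy $$x(t(\tau);x_0)=R\,y(\tau;y_0),\qquad R=\begin{bmatrix} I_{n_x} & 0_{n_x,1}\end{bmatrix}\in\mathbb{R}^{n_x\times(n_x+1)},$$ for every $\tau\in(0,\tau_{\mathrm f})$ such that $t(\tau)\in(0,t_{\mathrm f})$ and $t(\tau)\neq t_s$ (the last condition being void if no such $t_s$ exists). Here $I_{n_x}$ is the identity matrix and $0_{n_x,1}$ the zero column.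
   Context: **Notation.** For column vectors $a,b$, $(a,b)$ denotes their concatenation $[a^\top,b^\top]^\top$. $\dot x=dx/dt$ and $y'=dy/d\tau$. $x(t^+)$ and $x(t^-)$ denote right and left limits at $t$. **Sets.** $\psi$ is differentiable and $\dot\psi(x):=\nabla\psi(x)^\top f(x)$. - Feasible region: $V^+=\{x\mid \psi(x)\ge 0\}$. - Prohibited region: $V^-=\{x\mid\psi(x)<0\}$. - Switching manifold: $S=\{x\mid\psi(x)=0\}$. - $S^+=\{x\in S\mid \dot\psi(x)>0\}$, $S^-=\{x\in S\mid\dot\psi(x)<0\}$, $S^0=\{x\in S\mid\dot\psi(x)=0\}$. **Ordinary differential equation with state jumps.** The state $x(t)\in\mathbb{R}^{n_x}$ evolves according to $$\dot x(t)=f(x(t)),\quad x(t)\in V^+,$$ $$x(t^+)=\Gamma(x(t^-)),\quad\text{if }\psi(x(t))=0\text{ and }x(t^-)\in S^-,$$ where $\Gamma:S^-\to S^+$ is the restitution law. Thus a solution takes values in $V^+$, is absolutely continuous and satisfies $\dot x=f(x)$ between jumps, and jumps according to $\Gamma$ exactly at the times $t$ at which it reaches $S^-$, i.e. $x(t^-)\in S^-$. **Auxiliary Dynamics Assumption.** The auxiliary dynamic system $\tilde x'(\tau)=\varphi(\tilde x(\tau))$ is such that for every initial value $\tilde x(\tau_{\mathrm s})=\tilde x_0\in S^-$ the following holds on a finite and well-defined time interval $(\tau_{\mathrm s},\tau_{\mathrm r})$, with length $\tau_{\mathrm{jump}}:=\tau_{\mathrm r}-\tau_{\mathrm s}$: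 $\tilde x(\tau)\in V^-$ for all $\tau\in(\tau_{\mathrm s},\tau_{\mathrm r})$; the trajectory has its first intersection with $S$ (after $\tau_{\mathrm s}$) after the time $\tau_{\mathrm{jump}}$, i.e. at $\tau_{\mathrm r}$, with $\tilde x(\tau_{\mathrm r})\in S^+$; and $\tilde x(\tau_{\mathrm r})=\Gamma(\tilde x(\tau_{\mathrm s}))$. **Time-frozen differential equation.** With pseudo-time $\tau\in\mathbb{R}$ and state $y(\tau)=(\tilde x(\tau),t(\tau))\in\mathbb{R}^{n_x+1}$, where $t(\tau)$ is the scalar clock state, $$y'(\tau)=\begin{cases}\tilde f(y(\tau)), & \tilde\psi(y(\tau))\ge 0,\\ \tilde\varphi(y(\tau)), & \tilde\psi(y(\tau))<0,\end{cases}$$ with $\tilde f(y)=(f(\tilde x),1)$, $\tilde\varphi(y)=(\varphi(\tilde x),0)$ and $\tilde\psi(y)=\psi(\tilde x)$. Solutions are absolutely continuous functions of $\tau$ satisfying the equation for almost every $\tau$. **Convention.** Speaking of "the solution" of each initial value problem presupposes that it exists and is unique on the considered interval (and on subintervals starting at the initial time); the same applies to the solutions of $\tilde x'=\varphi(\tilde x)$ in the Auxiliary Dynamics Assumption. *)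

theory Defs
  imports "HOL-Analysis.Analysis"
begin

definition gradient :: "('a::real_inner \<Rightarrow> real) \<Rightarrow> 'a \<Rightarrow> 'a" where
  "gradient \<psi> x = (THE g. GDERIV \<psi> x :> g)"

definition psi_dot :: "('a::real_inner \<Rightarrow> 'a) \<Rightarrow> ('a \<Rightarrow> real) \<Rightarrow> 'a \<Rightarrow> real" where
  "psi_dot f \<psi> x = gradient \<psi> x \<bullet> f x"

definition V_pos :: "('a \<Rightarrow> real) \<Rightarrow> 'a set" where
  "V_pos \<psi> = {x. \<psi> x \<ge> 0}"

definition V_neg :: "('a \<Rightarrow> real) \<Rightarrow> 'a set" where
  "V_neg \<psi> = {x. \<psi> x < 0}"

definition S_all :: "('a \<Rightarrow> real) \<Rightarrow> 'a set" where
  "S_all \<psi> = {x. \<psi> x = 0}"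

definition S_pos :: "('a::real_inner \<Rightarrow> 'a) \<Rightarrow> ('a \<Rightarrow> real) \<Rightarrow> 'a set" where
  "S_pos f \<psi> = {x \<in> S_all \<psi>. psi_dot f \<psi> x > 0}"

definition S_neg :: "('a::real_inner \<Rightarrow> 'a) \<Rightarrow> ('a \<Rightarrow> real) \<Rightarrow> 'a set" where
  "S_neg f \<psi> = {x \<in> S_all \<psi>. psi_dot f \<psi> x < 0}"

text \<open>
  The usual epsilon-delta notion of absolute continuity of a function on an interval \<open>I\<close>.
  A pair in \<open>D\<close> is the pair of endpoints of one of finitely many non-overlapping subintervals.
  On a bounded open interval this forces one-sided limits at the endpoints.
\<close>

definition abs_continuous_on :: "real set \<Rightarrow> (real \<Rightarrow> 'a::real_normed_vector) \<Rightarrow> bool" where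
  "abs_continuous_on I x \<longleftrightarrow>
    (\<forall>\<epsilon>>0. \<exists>\<delta>>0. \<forall>D :: (real \<times> real) set.
       finite D \<and>
       (\<forall>(a, b)\<in>D. a \<le> b \<and> {a..b} \<subseteq> I) \<and>
       pairwise (\<lambda>p q. disjnt {fst p<..<snd p} {fst q<..<snd q}) D \<and>
       (\<Sum>(a, b)\<in>D. b - a) < \<delta>
       \<longrightarrow> (\<Sum>(a, b)\<in>D. norm (x b - x a)) < \<epsilon>)"

definition ode_solution ::
  "('a::real_normed_vector \<Rightarrow> 'a) \<Rightarrow> real \<Rightarrow> real \<Rightarrow> 'a \<Rightarrow> (real \<Rightarrow> 'a) \<Rightarrow> bool" where
  "ode_solution F a b y0 y \<longleftrightarrow>
     y a = y0 \<and>
     abs_continuous_on {a..b} y \<and>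
     (AE \<tau> in lebesgue. \<tau> \<in> {a<..<b} \<longrightarrow> (y has_vector_derivative F (y \<tau>)) (at \<tau>))"

definition unique_ode_solution ::
  "('a::real_normed_vector \<Rightarrow> 'a) \<Rightarrow> real \<Rightarrow> real \<Rightarrow> 'a \<Rightarrow> (real \<Rightarrow> 'a) \<Rightarrow> bool" where
  "unique_ode_solution F a b y0 y \<longleftrightarrow>
     ode_solution F a b y0 y \<and>
     (\<forall>c z. a < c \<and> c \<le> b \<and> ode_solution F a c y0 z \<longrightarrow> (\<forall>\<tau>\<in>{a..c}. z \<tau> = y \<tau>))"

definition jump_time ::
  "('a::real_inner \<Rightarrow> 'a) \<Rightarrow> ('a \<Rightarrow> real) \<Rightarrow> (real \<Rightarrow> 'a) \<Rightarrow> real \<Rightarrow> bool" where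
  "jump_time f \<psi> x t \<longleftrightarrow> (\<exists>l\<in>S_neg f \<psi>. (x \<longlongrightarrow> l) (at_left t))"

text \<open>
  The initial value \<open>x0\<close> plays the role of the left limit at time 0, so that the restitution law
  is applied at time 0 if \<open>x0\<close> lies in \<open>S_neg f \<psi>\<close>; otherwise the right limit at 0 is \<open>x0\<close>.
  At a jump time, the value of \<open>x\<close> itself (as opposed to its one-sided limits) is only required
  to lie on the switching manifold, which admits both the left- and the right-continuous version.
  For this reason, solutions are compared away from jump times in the definition of uniqueness.
\<close>

definition jump_solution ::
  "('a::real_inner \<Rightarrow> 'a) \<Rightarrow> ('a \<Rightarrow> real) \<Rightarrow> ('a \<Rightarrow> 'a) \<Rightarrow> real \<Rightarrow> 'a \<Rightarrow> (real \<Rightarrow> 'a) \<Rightarrow> bool" where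
  "jump_solution f \<psi> \<Gamma> T x0 x \<longleftrightarrow>
     (x \<longlongrightarrow> (if x0 \<in> S_neg f \<psi> then \<Gamma> x0 else x0)) (at_right 0) \<and>
     (\<forall>t\<in>{0<..<T}. x t \<in> V_pos \<psi>) \<and>
     (\<forall>t\<in>{0<..<T}. \<forall>l\<in>S_neg f \<psi>.
        (x \<longlongrightarrow> l) (at_left t) \<longrightarrow> \<psi> (x t) = 0 \<and> (x \<longlongrightarrow> \<Gamma> l) (at_right t)) \<and>
     (\<forall>t\<in>{0<..<T}. \<not> jump_time f \<psi> x t \<longrightarrow> isCont x t) \<and>
     (\<forall>a b. a < b \<and> {a<..<b} \<subseteq> {0<..<T} \<and> (\<forall>t\<in>{a<..<b}. \<not> jump_time f \<psi> x t) \<longrightarrow>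
        abs_continuous_on {a<..<b} x \<and>
        (AE t in lebesgue. t \<in> {a<..<b} \<longrightarrow> (x has_vector_derivative f (x t)) (at t)))"

definition unique_jump_solution ::
  "('a::real_inner \<Rightarrow> 'a) \<Rightarrow> ('a \<Rightarrow> real) \<Rightarrow> ('a \<Rightarrow> 'a) \<Rightarrow> real \<Rightarrow> 'a \<Rightarrow> (real \<Rightarrow> 'a) \<Rightarrow> bool" where
  "unique_jump_solution f \<psi> \<Gamma> T x0 x \<longleftrightarrow>
     jump_solution f \<psi> \<Gamma> T x0 x \<and>
     (\<forall>c z. 0 < c \<and> c \<le> T \<and> jump_solution f \<psi> \<Gamma> c x0 z \<longrightarrow>
        (\<forall>t\<in>{0<..<c}. \<not> jump_time f \<psi> x t \<longrightarrow> z t = x t))"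

text \<open>
  The end time \<open>\<tau>r\<close>, hence the length of the interval, may depend on the initial value.  That
  \<open>\<tau>r\<close> is the time of first return to the switching manifold is the combination of the
  conditions on the open interval and at \<open>\<tau>r\<close>.
\<close>

definition auxiliary_dynamics ::
  "('a::real_inner \<Rightarrow> 'a) \<Rightarrow> ('a \<Rightarrow> real) \<Rightarrow> ('a \<Rightarrow> 'a) \<Rightarrow> ('a \<Rightarrow> 'a) \<Rightarrow> bool" where
  "auxiliary_dynamics f \<psi> \<Gamma> \<phi> \<longleftrightarrow>
     (\<forall>\<tau>s. \<forall>x0\<in>S_neg f \<psi>. \<exists>\<tau>r>\<tau>s. \<exists>x.
        unique_ode_solution \<phi> \<tau>s \<tau>r x0 x \<and>
        (\<forall>\<tau>\<in>{\<tau>s<..<\<tau>r}. x \<tau> \<in> V_neg \<psi>) \<and>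
        x \<tau>r \<in> S_pos f \<psi> \<and>
        x \<tau>r = \<Gamma> (x \<tau>s))"

text \<open>
  The space of dimension \<open>n + 1\<close> is \<open>real ^ ('n + unit)\<close>; the index \<open>Inr ()\<close> is that of the clock.
\<close>

definition concat_vec :: "real ^ 'n \<Rightarrow> real \<Rightarrow> real ^ ('n + unit)" where
  "concat_vec a s = (\<chi> i. case i of Inl k \<Rightarrow> a $ k | Inr _ \<Rightarrow> s)"

definition state_part :: "real ^ ('n + unit) \<Rightarrow> real ^ 'n" where
  "state_part y = (\<chi> k. y $ Inl k)"

definition time_frozen_field ::
  "(real ^ 'n \<Rightarrow> real ^ 'n) \<Rightarrow> (real ^ 'n \<Rightarrow> real) \<Rightarrow> (real ^ 'n \<Rightarrow> real ^ 'n) \<Rightarrow>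
   real ^ ('n + unit) \<Rightarrow> real ^ ('n + unit)" where
  "time_frozen_field f \<psi> \<phi> y =
     (if \<psi> (state_part y) \<ge> 0 then concat_vec (f (state_part y)) 1
      else concat_vec (\<phi> (state_part y)) 0)"

definition R_mat :: "real ^ ('n + unit) ^ 'n" where
  "R_mat = (\<chi> i j. case j of Inl k \<Rightarrow> mat 1 $ i $ k | Inr _ \<Rightarrow> 0)"

end

theory Submission
  imports Defs
begin

text \<open>
  The time-frozen solution \<open>y\<close> is assumed unique, so it suffices to build, from the jump solution \<open>x\<close>,
  some solution \<open>w\<close> of the time-frozen equation that visibly follows \<open>x\<close>.  Where \<open>x\<close> moves without
  jumps it stays in the feasible region, and attaching a clock of rate 1 gives a solution of the
  time-frozen equation (\<open>tracking_run_flight\<close>).  Where \<open>x\<close> jumps from \<open>l\<close> to \<open>\<Gamma> l\<close>, the auxiliary dynamics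
  connects these two states through the prohibited region, and attaching a stopped clock again gives
  a solution (\<open>tracking_run_impact\<close>).  A jump time is a zero of \<open>\<psi> \<circ> x\<close>, so there is at most one in the
  open time interval, and the pieces can be concatenated (\<open>tracking_run_to\<close>); an initial value in
  \<open>S_neg f \<psi>\<close> only puts one more auxiliary arc in front.

  Let \<open>\<tau>\<close> be a pseudo-time in question and build \<open>w\<close> until its clock shows some \<open>c\<close> with
  \<open>clock \<tau> < c < tf\<close>, reached at pseudo-time \<open>L\<close>.  Uniqueness gives \<open>y = w\<close> up to the smaller of \<open>L\<close> and
  \<open>\<tau>f\<close>.  If \<open>\<tau> \<le> L\<close>, then the state of \<open>y\<close> at \<open>\<tau>\<close> is that of \<open>w\<close>, namely \<open>x (clock \<tau>)\<close>,
  because \<open>\<psi> \<circ> x\<close> does not vanish at \<open>clock \<tau>\<close> and so this is not a jump time.  The case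
  \<open>L < \<tau>\<close> is impossible: the clock of \<open>y\<close> would show \<open>c\<close> at \<open>L\<close> and the smaller value \<open>clock \<tau>\<close> later,
  although its derivative is almost everywhere 0 or 1.  That an absolutely continuous function with
  almost everywhere nonnegative derivative is nondecreasing is
  \<open>abs_continuous_mono_of_deriv_nonneg\<close>.

  The analytic work is to show that the assembled \<open>w\<close> is absolutely continuous.  It rests on the
  observation that monotone, distance-nonincreasing changes of time preserve the modulus of absolute
  continuity (\<open>ac_modulus_reparam\<close>).
\<close>

section \<open>Absolute continuity: reparametrisation and end points\<close>

definition interval_family :: "real set \<Rightarrow> (real \<times> real) set \<Rightarrow> bool" where
  "interval_family I D \<longleftrightarrow>
     finite D \<and> (\<forall>(a, b)\<in>D. a \<le> b \<and> {a..b} \<subseteq> I) \<and>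
     pairwise (\<lambda>p q. disjnt {fst p<..<snd p} {fst q<..<snd q}) D"

text \<open>
  Keeping the witness \<open>\<delta>\<close> explicit allows one modulus to be shared by a whole family of
  reparametrised functions, and hence to survive a pointwise limit over that family.
\<close>

definition ac_modulus :: "real set \<Rightarrow> (real \<Rightarrow> 'a::real_normed_vector) \<Rightarrow> real \<Rightarrow> real \<Rightarrow> bool" where
  "ac_modulus I x \<epsilon> \<delta> \<longleftrightarrow>
     (\<forall>D. interval_family I D \<and> (\<Sum>(a, b)\<in>D. b - a) < \<delta>
        \<longrightarrow> (\<Sum>(a, b)\<in>D. norm (x b - x a)) < \<epsilon>)"

lemma abs_continuous_on_iff_modulus:
  "abs_continuous_on I x \<longleftrightarrow> (\<forall>\<epsilon>>0. \<exists>\<delta>>0. ac_modulus I x \<epsilon> \<delta>)"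
  unfolding abs_continuous_on_def ac_modulus_def interval_family_def by (simp only: conj_assoc)

lemma interval_familyD:
  assumes "interval_family I D" "(a, b) \<in> D"
  shows "a \<le> b" "{a..b} \<subseteq> I"
  using assms unfolding interval_family_def by auto

lemma disjoint_intervals_ordered:
  fixes a b c d :: real
  assumes "disjnt {a<..<b} {c<..<d}" "a < b" "c < d"
  shows "b \<le> c \<or> d \<le> a"
proof (rule ccontr)
  assume "\<not> (b \<le> c \<or> d \<le> a)"
  then have "max a c < min b d" using assms by auto
  then obtain m where "max a c < m" "m < min b d" using dense by blast
  then have "m \<in> {a<..<b}" "m \<in> {c<..<d}" by auto
  then show False using assms(1) by (auto simp: disjnt_iff)
qed

text \<open>
  A monotone map that does not increase distances carries a family of non-overlapping intervals to
  another one whose total length is no larger, so the modulus is inherited unchanged.  Truncations,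
  translations and retractions onto a smaller interval are all of this kind.
\<close>

lemma ac_modulus_reparam:
  fixes x :: "real \<Rightarrow> 'a::real_normed_vector" and g :: "real \<Rightarrow> real"
  assumes x: "ac_modulus J x \<epsilon> \<delta>"
    and J: "\<And>s t. s \<in> J \<Longrightarrow> t \<in> J \<Longrightarrow> {s..t} \<subseteq> J"
    and g: "\<And>t. t \<in> I \<Longrightarrow> g t \<in> J"
    and mono: "\<And>s t. s \<in> I \<Longrightarrow> t \<in> I \<Longrightarrow> s \<le> t \<Longrightarrow> g s \<le> g t"
    and lip: "\<And>s t. s \<in> I \<Longrightarrow> t \<in> I \<Longrightarrow> s \<le> t \<Longrightarrow> g t - g s \<le> t - s"
  shows "ac_modulus I (\<lambda>t. x (g t)) \<epsilon> \<delta>"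
  unfolding ac_modulus_def
proof (intro allI impI, elim conjE)
  fix D assume D: "interval_family I D" and len: "(\<Sum>(a, b)\<in>D. b - a) < \<delta>"
  have finD: "finite D" using D by (simp add: interval_family_def)
  have inI: "a \<in> I" "b \<in> I" "a \<le> b" if "(a, b) \<in> D" for a b
    using interval_familyD[OF D that] by auto
  \<comment> \<open>Intervals collapsed by \<open>g\<close> contribute nothing; on the others \<open>g\<close> keeps the intervals apart.\<close>
  define E where "E = {p \<in> D. g (fst p) < g (snd p)}"
  let ?G = "map_prod g g"
  have ED: "E \<subseteq> D" and finE: "finite E" using finD by (auto simp: E_def)
  have ord: "snd p \<le> fst q \<or> snd q \<le> fst p" if "p \<in> E" "q \<in> E" "p \<noteq> q" for p q
  proof -
    have "fst p < snd p" "fst q < snd q"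
      using that inI[of "fst p" "snd p"] inI[of "fst q" "snd q"]
      by (auto simp: E_def order.strict_iff_order)
    moreover have "disjnt {fst p<..<snd p} {fst q<..<snd q}"
      using D that ED unfolding interval_family_def pairwise_def by blast
    ultimately show ?thesis using disjoint_intervals_ordered by blast
  qed
  have ordG: "g (snd p) \<le> g (fst q) \<or> g (snd q) \<le> g (fst p)" if "p \<in> E" "q \<in> E" "p \<noteq> q" for p q
  proof -
    have "p \<in> D" "q \<in> D" using that ED by auto
    then show ?thesis
      using ord[OF that] inI(1,2)[of "fst p" "snd p"] inI(1,2)[of "fst q" "snd q"]
        mono[of "snd p" "fst q"] mono[of "snd q" "fst p"]
      by (metis prod.collapse)
  qed
  have inj: "inj_on ?G E"
  proof (rule inj_onI, rule ccontr)
    fix p q assume "p \<in> E" "q \<in> E" "?G p = ?G q" "p \<noteq> q"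
    then show False using ordG[of p q] by (auto simp: E_def map_prod_def split: prod.splits)
  qed
  have fam: "interval_family J (?G ` E)"
    unfolding interval_family_def
  proof (intro conjI)
    show "finite (?G ` E)" using finE by simp
    show "\<forall>(a, b)\<in>?G ` E. a \<le> b \<and> {a..b} \<subseteq> J"
    proof clarsimp
      fix a b assume "(a, b) \<in> E"
      then have "(a, b) \<in> D" using ED by blast
      from inI[OF this] show "g a \<le> g b \<and> {g a..g b} \<subseteq> J" using mono J g by auto
    qed
    show "pairwise (\<lambda>p q. disjnt {fst p<..<snd p} {fst q<..<snd q}) (?G ` E)"
    proof (rule pairwiseI)
      fix P Q assume PQ: "P \<in> ?G ` E" "Q \<in> ?G ` E" "P \<noteq> Q"
      obtain p where p: "P = ?G p" "p \<in> E" using PQ(1) by (rule imageE)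
      obtain q where q: "Q = ?G q" "q \<in> E" using PQ(2) by (rule imageE)
      have "p \<noteq> q" using p(1) q(1) PQ(3) by metis
      note pq = p(2) q(2) this p(1) q(1)
      have "snd P \<le> fst Q \<or> snd Q \<le> fst P"
        using ordG[OF pq(1-3)] unfolding pq(4,5) by simp
      then show "disjnt {fst P<..<snd P} {fst Q<..<snd Q}"
        unfolding disjnt_iff by auto
    qed
  qed
  have "(\<Sum>(a, b)\<in>?G ` E. b - a) = (\<Sum>(a, b)\<in>E. g b - g a)"
    by (subst sum.reindex[OF inj]) (simp add: case_prod_unfold)
  also have "\<dots> \<le> (\<Sum>(a, b)\<in>E. b - a)"
  proof (rule sum_mono, clarify)
    fix a b assume "(a, b) \<in> E"
    with ED have "(a, b) \<in> D" by blast
    from lip[OF inI[OF this]] show "g b - g a \<le> b - a" .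
  qed
  also have "\<dots> \<le> (\<Sum>(a, b)\<in>D. b - a)"
  proof (rule sum_mono2[OF finD ED], clarify)
    show "0 \<le> b - a" if "(a, b) \<in> D" for a b using inI(3)[OF that] by simp
  qed
  finally have "(\<Sum>(a, b)\<in>?G ` E. b - a) < \<delta>" using len by simp
  with x fam have "(\<Sum>(a, b)\<in>?G ` E. norm (x b - x a)) < \<epsilon>"
    unfolding ac_modulus_def by blast
  moreover have "(\<Sum>(a, b)\<in>?G ` E. norm (x b - x a)) = (\<Sum>(a, b)\<in>E. norm (x (g b) - x (g a)))"
    by (subst sum.reindex[OF inj]) (simp add: case_prod_unfold)
  moreover have "(\<Sum>(a, b)\<in>E. norm (x (g b) - x (g a))) = (\<Sum>(a, b)\<in>D. norm (x (g b) - x (g a)))"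
  proof (rule sum.mono_neutral_left[OF finD ED], clarsimp)
    fix a b assume ab: "(a, b) \<in> D" "(a, b) \<notin> E"
    with mono[of a b] inI[OF ab(1)] have "g a = g b" by (auto simp: E_def)
    then show "x (g b) = x (g a)" by simp
  qed
  ultimately show "(\<Sum>(a, b)\<in>D. norm (x (g b) - x (g a))) < \<epsilon>" by simp
qed

lemma abs_continuous_on_reparam:
  fixes x :: "real \<Rightarrow> 'a::real_normed_vector"
  assumes x: "abs_continuous_on J x"
    and "\<And>s t. s \<in> J \<Longrightarrow> t \<in> J \<Longrightarrow> {s..t} \<subseteq> J"
    and "\<And>t. t \<in> I \<Longrightarrow> g t \<in> J"
    and "\<And>s t. s \<in> I \<Longrightarrow> t \<in> I \<Longrightarrow> s \<le> t \<Longrightarrow> g s \<le> g t"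
    and "\<And>s t. s \<in> I \<Longrightarrow> t \<in> I \<Longrightarrow> s \<le> t \<Longrightarrow> g t - g s \<le> t - s"
  shows "abs_continuous_on I (\<lambda>t. x (g t))"
  unfolding abs_continuous_on_iff_modulus
proof (intro allI impI)
  fix \<epsilon> :: real assume "\<epsilon> > 0"
  then obtain \<delta> where "\<delta> > 0" "ac_modulus J x \<epsilon> \<delta>"
    using x unfolding abs_continuous_on_iff_modulus by blast
  moreover have "ac_modulus I (\<lambda>t. x (g t)) \<epsilon> \<delta>"
    by (rule ac_modulus_reparam[OF \<open>ac_modulus J x \<epsilon> \<delta>\<close>]) (fact assms)+
  ultimately show "\<exists>\<delta>>0. ac_modulus I (\<lambda>t. x (g t)) \<epsilon> \<delta>" by blast
qed

lemma abs_continuous_on_subset: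
  assumes x: "abs_continuous_on I x" and "J \<subseteq> I"
  shows "abs_continuous_on J x"
  unfolding abs_continuous_on_iff_modulus
proof (intro allI impI)
  fix \<epsilon> :: real assume "\<epsilon> > 0"
  then obtain \<delta> where "\<delta> > 0" "ac_modulus I x \<epsilon> \<delta>"
    using x unfolding abs_continuous_on_iff_modulus by blast
  moreover have "interval_family I D" if "interval_family J D" for D
    using that \<open>J \<subseteq> I\<close> unfolding interval_family_def by fast
  ultimately show "\<exists>\<delta>>0. ac_modulus J x \<epsilon> \<delta>" unfolding ac_modulus_def by blast
qed

text \<open>
  Covers gluing two functions at a common value and pairing a state with a clock: in both cases an
  increment of the result is bounded by the increments of the two parts.
\<close>

lemma abs_continuous_on_dominated:
  fixes u :: "real \<Rightarrow> 'a::real_normed_vector" and v :: "real \<Rightarrow> 'b::real_normed_vector"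
    and w :: "real \<Rightarrow> 'c::real_normed_vector"
  assumes u: "abs_continuous_on I u" and v: "abs_continuous_on I v"
    and le: "\<And>a b. a \<in> I \<Longrightarrow> b \<in> I \<Longrightarrow> norm (w b - w a) \<le> norm (u b - u a) + norm (v b - v a)"
  shows "abs_continuous_on I w"
  unfolding abs_continuous_on_iff_modulus
proof (intro allI impI)
  fix \<epsilon> :: real assume "\<epsilon> > 0"
  then have "\<epsilon> / 2 > 0" by simp
  obtain \<delta>1 where 1: "\<delta>1 > 0" "ac_modulus I u (\<epsilon> / 2) \<delta>1"
    using u \<open>\<epsilon> / 2 > 0\<close> unfolding abs_continuous_on_iff_modulus by blast
  obtain \<delta>2 where 2: "\<delta>2 > 0" "ac_modulus I v (\<epsilon> / 2) \<delta>2"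
    using v \<open>\<epsilon> / 2 > 0\<close> unfolding abs_continuous_on_iff_modulus by blast
  have "ac_modulus I w \<epsilon> (min \<delta>1 \<delta>2)"
    unfolding ac_modulus_def
  proof (intro allI impI, elim conjE)
    fix D assume D: "interval_family I D" and len: "(\<Sum>(a, b)\<in>D. b - a) < min \<delta>1 \<delta>2"
    have "(\<Sum>(a, b)\<in>D. norm (w b - w a)) \<le> (\<Sum>(a, b)\<in>D. norm (u b - u a) + norm (v b - v a))"
    proof (rule sum_mono, clarify)
      fix a b assume "(a, b) \<in> D"
      from interval_familyD[OF D this] show "norm (w b - w a) \<le> norm (u b - u a) + norm (v b - v a)"
        by (intro le) auto
    qed
    also have "\<dots> = (\<Sum>(a, b)\<in>D. norm (u b - u a)) + (\<Sum>(a, b)\<in>D. norm (v b - v a))"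
      by (simp add: case_prod_unfold sum.distrib)
    also have "\<dots> < \<epsilon> / 2 + \<epsilon> / 2"
      using 1 2 D len unfolding ac_modulus_def by (intro add_strict_mono) auto
    finally show "(\<Sum>(a, b)\<in>D. norm (w b - w a)) < \<epsilon>" by simp
  qed
  then show "\<exists>\<delta>>0. ac_modulus I w \<epsilon> \<delta>" using 1 2 by (metis min_less_iff_conj)
qed

lemma abs_continuous_on_const: "abs_continuous_on I (\<lambda>_. c)"
  unfolding abs_continuous_on_def by (intro allI impI exI[of _ 1]) (simp add: case_prod_unfold)

lemma abs_continuous_on_ident: "abs_continuous_on I (\<lambda>t::real. t)"
  unfolding abs_continuous_on_iff_modulus
proof (intro allI impI)
  fix \<epsilon> :: real assume "\<epsilon> > 0"
  moreover have "ac_modulus I (\<lambda>t. t) \<epsilon> \<epsilon>"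
    unfolding ac_modulus_def
  proof (intro allI impI, elim conjE)
    fix D :: "(real \<times> real) set" assume D: "interval_family I D" "(\<Sum>(a, b)\<in>D. b - a) < \<epsilon>"
    have "(\<Sum>(a, b)\<in>D. norm (b - a)) = (\<Sum>(a, b)\<in>D. b - a)"
      using interval_familyD[OF D(1)] by (intro sum.cong) auto
    then show "(\<Sum>(a, b)\<in>D. norm (b - a)) < \<epsilon>" using D(2) by simp
  qed
  ultimately show "\<exists>\<delta>>0. ac_modulus I (\<lambda>t. t) \<epsilon> \<delta>" by blast
qed

definition close_ends :: "real \<Rightarrow> real \<Rightarrow> 'a \<Rightarrow> 'a \<Rightarrow> (real \<Rightarrow> 'a) \<Rightarrow> real \<Rightarrow> 'a" where
  "close_ends a b p q x t = (if t \<le> a then p else if b \<le> t then q else x t)"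

text \<open>
  Clipping time to \<open>{a + \<eta>..b - \<eta>}\<close> turns \<open>x\<close> into functions on \<open>{a..b}\<close> that all have the modulus of
  \<open>x\<close> and converge pointwise to its continuous extension as \<open>\<eta>\<close> tends to 0.  The strict bound is
  recovered in the limit by starting from \<open>\<epsilon> / 2\<close>.
\<close>

lemma abs_continuous_on_close_ends:
  fixes x :: "real \<Rightarrow> 'a::real_normed_vector"
  assumes "a < b" and x: "abs_continuous_on {a<..<b} x"
    and p: "(x \<longlongrightarrow> p) (at_right a)" and q: "(x \<longlongrightarrow> q) (at_left b)"
  shows "abs_continuous_on {a..b} (close_ends a b p q x)"
  unfolding abs_continuous_on_iff_modulus
proof (intro allI impI)
  fix \<epsilon> :: real assume "\<epsilon> > 0"
  then have "\<epsilon> / 2 > 0" by simp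
  then obtain \<delta> where \<delta>: "\<delta> > 0" "ac_modulus {a<..<b} x (\<epsilon> / 2) \<delta>"
    using x unfolding abs_continuous_on_iff_modulus by blast
  \<comment> \<open>The clipping of time to the shrunken interval.\<close>
  define g where "g \<eta> t = max (a + \<eta>) (min t (b - \<eta>))" for \<eta> t :: real
  have small: "\<forall>\<^sub>F \<eta> in at_right 0. 0 < \<eta> \<and> \<eta> < e" if "e > 0" for e :: real
    using that unfolding eventually_at_right_field by auto
  have lim: "((\<lambda>\<eta>. x (g \<eta> t)) \<longlongrightarrow> close_ends a b p q x t) (at_right 0)" for t
  proof -
    consider "t \<le> a" | "b \<le> t" | "a < t" "t < b" by linarith
    then show ?thesis
    proof cases
      case 1
      have "((\<lambda>\<eta>. x (\<eta> + a)) \<longlongrightarrow> p) (at_right 0)"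
        using p by (simp add: filterlim_at_right_to_0[of _ _ a])
      moreover have "\<forall>\<^sub>F \<eta> in at_right 0. x (\<eta> + a) = x (g \<eta> t)"
        using small[of "(b - a)/2"] \<open>a < b\<close> 1
        by (auto elim!: eventually_mono simp: g_def max_def min_def add.commute)
      ultimately show ?thesis using 1 by (auto simp: close_ends_def intro: Lim_transform_eventually)
    next
      case 2
      have "((\<lambda>\<eta>. x (- (\<eta> + - b))) \<longlongrightarrow> q) (at_right 0)"
        using q unfolding filterlim_at_left_to_right[of _ _ b] filterlim_at_right_to_0[of _ _ "-b"] .
      moreover have "\<forall>\<^sub>F \<eta> in at_right 0. x (- (\<eta> + - b)) = x (g \<eta> t)"
        using small[of "(b - a)/2"] \<open>a < b\<close> 2
        by (auto elim!: eventually_mono simp: g_def max_def min_def)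
      ultimately show ?thesis using 2 \<open>a < b\<close>
        by (auto simp: close_ends_def intro: Lim_transform_eventually)
    next
      case 3
      have "\<forall>\<^sub>F \<eta> in at_right 0. x t = x (g \<eta> t)"
      proof (rule eventually_mono[OF small[of "min (t - a) (b - t)"]])
        show "0 < min (t - a) (b - t)" using 3 by simp
        show "x t = x (g \<eta> t)" if "0 < \<eta> \<and> \<eta> < min (t - a) (b - t)" for \<eta>
          using that by (auto simp: g_def)
      qed
      then show ?thesis using 3
        by (auto simp: close_ends_def intro: Lim_transform_eventually[OF tendsto_const])
    qed
  qed
  have "ac_modulus {a..b} (close_ends a b p q x) \<epsilon> \<delta>"
    unfolding ac_modulus_def
  proof (intro allI impI, elim conjE)
    fix D assume D: "interval_family {a..b} D" and len: "(\<Sum>(s, t)\<in>D. t - s) < \<delta>"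
    have "\<forall>\<^sub>F \<eta> in at_right 0. (\<Sum>(s, t)\<in>D. norm (x (g \<eta> t) - x (g \<eta> s))) \<le> \<epsilon> / 2"
    proof (rule eventually_mono[OF small[of "(b - a) / 2"]])
      show "(b - a) / 2 > 0" using \<open>a < b\<close> by simp
      fix \<eta> assume \<eta>: "0 < \<eta> \<and> \<eta> < (b - a) / 2"
      have "ac_modulus {a..b} (\<lambda>t. x (g \<eta> t)) (\<epsilon> / 2) \<delta>"
        by (rule ac_modulus_reparam[OF \<delta>(2)]) (use \<eta> in \<open>auto simp: g_def max_def min_def\<close>)
      then show "(\<Sum>(s, t)\<in>D. norm (x (g \<eta> t) - x (g \<eta> s))) \<le> \<epsilon> / 2"
        using D len unfolding ac_modulus_def by (blast intro: less_imp_le)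
    qed
    moreover have "((\<lambda>\<eta>. \<Sum>(s, t)\<in>D. norm (x (g \<eta> t) - x (g \<eta> s))) \<longlongrightarrow>
        (\<Sum>(s, t)\<in>D. norm (close_ends a b p q x t - close_ends a b p q x s))) (at_right 0)"
      unfolding case_prod_unfold by (intro tendsto_intros lim)
    ultimately have "(\<Sum>(s, t)\<in>D. norm (close_ends a b p q x t - close_ends a b p q x s)) \<le> \<epsilon> / 2"
      by (intro tendsto_upperbound) auto
    then show "(\<Sum>(s, t)\<in>D. norm (close_ends a b p q x t - close_ends a b p q x s)) < \<epsilon>"
      using \<open>\<epsilon> > 0\<close> by linarith
  qed
  then show "\<exists>\<delta>>0. ac_modulus {a..b} (close_ends a b p q x) \<epsilon> \<delta>" using \<delta>(1) by blast
qed

section \<open>Monotonicity from the sign of the derivative\<close>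

text \<open>
  The exceptional null set \<open>N\<close> is put into an open set \<open>U\<close> so small that absolute continuity bounds
  the variation of \<open>g\<close> over intervals inside \<open>U\<close>.  A gauge sends tags in \<open>N\<close> into \<open>U\<close> and every other
  tag into a ball on which \<open>g\<close> decreases at a rate of at most \<open>e2\<close>.  Summing the increments of \<open>g\<close> over
  a fine tagged division, the two kinds of intervals each lose at most half of \<open>e\<close>.
\<close>

lemma abs_continuous_mono_of_deriv_nonneg:
  fixes g :: "real \<Rightarrow> real"
  assumes "a \<le> b" and ac: "abs_continuous_on {a..b} g"
    and der: "AE t in lebesgue. t \<in> {a<..<b} \<longrightarrow> (\<exists>D\<ge>0. (g has_real_derivative D) (at t))"
  shows "g a \<le> g b"
proof (rule field_le_epsilon)
  fix e :: real assume "e > 0"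
  define e1 where "e1 = e / 2"
  define e2 where "e2 = e / (2 * (b - a + 1))"
  have "e1 > 0" "e2 > 0" "e2 * (b - a) \<le> e / 2"
    using \<open>e > 0\<close> \<open>a \<le> b\<close> by (auto simp: e1_def e2_def field_simps)
  obtain \<delta> where "\<delta> > 0" and \<delta>: "ac_modulus {a..b} g e1 \<delta>"
    using ac \<open>e1 > 0\<close> unfolding abs_continuous_on_iff_modulus by blast
  obtain N0 where N0: "N0 \<in> null_sets lebesgue"
    "{t. \<not> (t \<in> {a<..<b} \<longrightarrow> (\<exists>D\<ge>0. (g has_real_derivative D) (at t)))} \<subseteq> N0"
    using der unfolding eventually_ae_filter by auto
  \<comment> \<open>Nothing is known about derivatives at the end points, so they join the null set.\<close>
  define N where "N = N0 \<union> {a, b}"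
  have "negligible N"
    using N0(1) unfolding N_def negligible_iff_null_sets[symmetric]
    by simp
  then have nullN: "N \<in> null_sets lebesgue" by (simp add: negligible_iff_null_sets)
  obtain U where U: "open U" "N \<subseteq> U" "U - N \<in> lmeasurable" "emeasure lebesgue (U - N) < ennreal \<delta>"
    using sets_lebesgue_outer_open[of N \<delta>] nullN \<open>\<delta> > 0\<close> by (auto simp: null_sets_def)
  have U_sets: "U \<in> sets lebesgue" using U(1) by (simp add: borel_open)
  have U_lt: "emeasure lebesgue U < ennreal \<delta>"
    using U(4) emeasure_Diff_null_set[OF nullN U_sets] by simp
  have slope: "\<exists>d>0. \<forall>s. \<bar>s - t\<bar> < d \<longrightarrow>
      (t \<le> s \<longrightarrow> g s - g t \<ge> - e2 * (s - t)) \<and> (s \<le> t \<longrightarrow> g t - g s \<ge> - e2 * (t - s))"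
    if tN: "t \<in> {a..b} - N" for t
  proof -
    obtain D where D: "D \<ge> 0" "(g has_real_derivative D) (at t)"
    proof -
      have "t \<in> {a<..<b}" "t \<notin> N0" using tN by (auto simp: N_def)
      then show thesis using N0(2) that by blast
    qed
    obtain d where "d > 0"
      and d: "\<And>s. \<bar>s - t\<bar> < d \<Longrightarrow> \<bar>g s - g t - D * (s - t)\<bar> \<le> e2 * \<bar>s - t\<bar>"
      using D(2) \<open>e2 > 0\<close>
      unfolding has_field_derivative_def has_derivative_at_alt by (auto simp: mult.commute)
    have "(t \<le> s \<longrightarrow> g s - g t \<ge> - e2 * (s - t)) \<and> (s \<le> t \<longrightarrow> g t - g s \<ge> - e2 * (t - s))"
      if "\<bar>s - t\<bar> < d" for s
    proof (intro conjI impI)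
      assume "t \<le> s"
      then have "D * (s - t) \<ge> 0" "\<bar>s - t\<bar> = s - t" using D(1) by auto
      with d[OF that] show "g s - g t \<ge> - e2 * (s - t)" by (simp add: abs_le_iff)
    next
      assume "s \<le> t"
      then have "D * (t - s) \<ge> 0" "\<bar>s - t\<bar> = t - s" using D(1) by auto
      with d[OF that] show "g t - g s \<ge> - e2 * (t - s)" by (simp add: abs_le_iff algebra_simps)
    qed
    then show ?thesis using \<open>d > 0\<close> by blast
  qed
  then obtain d where d: "\<And>t. t \<in> {a..b} - N \<Longrightarrow> d t > 0"
    "\<And>t s. t \<in> {a..b} - N \<Longrightarrow> \<bar>s - t\<bar> < d t \<Longrightarrow>
      (t \<le> s \<longrightarrow> g s - g t \<ge> - e2 * (s - t)) \<and> (s \<le> t \<longrightarrow> g t - g s \<ge> - e2 * (t - s))"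
    by metis
  define \<gamma> where "\<gamma> t = (if t \<in> N then U else if t \<in> {a..b} then ball t (d t) else ball t 1)" for t
  have "gauge \<gamma>"
    using U d(1) unfolding gauge_def \<gamma>_def by auto
  then obtain p where p: "p tagged_division_of {a..b}" and fine: "\<gamma> fine p"
    using fine_division_exists_real by blast
  note pD = tagged_division_ofD[OF p]
  have K: "K = {Inf K..Sup K}" "Inf K \<le> t" "t \<le> Sup K" "{Inf K..Sup K} \<subseteq> {a..b}" "K \<subseteq> \<gamma> t"
    if tK: "(t, K) \<in> p" for t K
  proof -
    obtain u v where uv: "K = {u..v}" using pD(4)[OF tK] by auto
    moreover have "t \<in> K" using pD(2)[OF tK] .
    ultimately show "K = {Inf K..Sup K}" "Inf K \<le> t" "t \<le> Sup K" by auto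
    then show "{Inf K..Sup K} \<subseteq> {a..b}" using pD(3)[OF tK] by auto
    show "K \<subseteq> \<gamma> t" using fine tK by (auto simp: fine_def)
  qed
  \<comment> \<open>Degenerate intervals are left out, so that distinct members of \<open>P\<close> have distinct end points.\<close>
  define P where "P = {tK \<in> p. fst tK \<in> N \<and> Inf (snd tK) < Sup (snd tK)}"
  define ends where "ends tK = (Inf (snd tK), Sup (snd tK))" for tK :: "real \<times> real set"
  have "P \<subseteq> p" "finite p" "finite P" using pD(1) by (auto simp: P_def)
  have disj: "{Inf (snd A)<..<Sup (snd A)} \<inter> {Inf (snd B)<..<Sup (snd B)} = {}"
    if "A \<in> p" "B \<in> p" "A \<noteq> B" for A B
  proof -
    have "interior (snd A) \<inter> interior (snd B) = {}"
      using pD(5)[of "fst A" "snd A" "fst B" "snd B"] that by (simp add: prod_eq_iff)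
    then show ?thesis
      using K(1)[of "fst A" "snd A"] K(1)[of "fst B" "snd B"] that
      by (metis interior_atLeastAtMost_real prod.collapse)
  qed
  have inj: "inj_on ends P"
  proof (rule inj_onI, rule ccontr)
    fix A B assume AB: "A \<in> P" "B \<in> P" "ends A = ends B" "A \<noteq> B"
    then have "{Inf (snd A)<..<Sup (snd A)} = {}"
      using disj[of A B] by (auto simp: P_def ends_def)
    then show False using AB(1) by (simp add: P_def)
  qed
  have fam: "interval_family {a..b} (ends ` P)"
    unfolding interval_family_def
  proof (intro conjI)
    show "finite (ends ` P)" using \<open>finite P\<close> by simp
    show "\<forall>(s, t)\<in>ends ` P. s \<le> t \<and> {s..t} \<subseteq> {a..b}"
      using K(4) by (fastforce simp: P_def ends_def)
    show "pairwise (\<lambda>p q. disjnt {fst p<..<snd p} {fst q<..<snd q}) (ends ` P)"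
    proof (rule pairwiseI)
      fix X Y assume "X \<in> ends ` P" "Y \<in> ends ` P" "X \<noteq> Y"
      then obtain A B where "A \<in> p" "B \<in> p" "A \<noteq> B" "X = ends A" "Y = ends B"
        using \<open>P \<subseteq> p\<close> by blast
      then show "disjnt {fst X<..<snd X} {fst Y<..<snd Y}"
        using disj[of A B] by (simp add: ends_def disjnt_def)
    qed
  qed
  let ?J = "\<lambda>A::real \<times> real set. {Inf (snd A)<..<Sup (snd A)}"
  have "(\<Sum>A\<in>P. Sup (snd A) - Inf (snd A)) = (\<Sum>A\<in>P. measure lebesgue (?J A))"
    by (intro sum.cong) (auto simp: P_def)
  also have "\<dots> = measure lebesgue (\<Union>A\<in>P. ?J A)"
  proof (rule measure_finite_Union[symmetric])
    show "disjoint_family_on ?J P"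
      unfolding disjoint_family_on_def
    proof (intro ballI impI)
      fix A B assume "A \<in> P" "B \<in> P" "A \<noteq> B"
      then show "?J A \<inter> ?J B = {}"
        by (intro disj subsetD[OF \<open>P \<subseteq> p\<close>])
    qed
    show "emeasure lebesgue (?J A) \<noteq> \<infinity>" if "A \<in> P" for A
      using that by (simp add: P_def)
  qed (use \<open>finite P\<close> in auto)
  also have "\<dots> \<le> measure lebesgue U"
  proof (rule measure_mono_fmeasurable)
    show "(\<Union>A\<in>P. ?J A) \<subseteq> U"
    proof
      fix s assume "s \<in> (\<Union>A\<in>P. ?J A)"
      then obtain t K where tK: "(t, K) \<in> p" "t \<in> N" "Inf K < s" "s < Sup K" by (auto simp: P_def)
      then have "s \<in> K" using K(1)[OF tK(1)] by (metis atLeastAtMost_iff less_imp_le)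
      then show "s \<in> U" using K(5)[OF tK(1)] tK(2) by (auto simp: \<gamma>_def)
    qed
    show "(\<Union>A\<in>P. ?J A) \<in> sets lebesgue" using \<open>finite P\<close> by auto
    show "U \<in> lmeasurable" using U_sets U_lt by (auto simp: fmeasurable_def less_top[symmetric] intro: order.strict_trans)
  qed
  also have "\<dots> < \<delta>"
    using U_lt \<open>\<delta> > 0\<close> unfolding measure_def
    by (metis enn2real_less_iff ennreal_less_top order.strict_trans)
  finally have "(\<Sum>(s, t)\<in>ends ` P. t - s) < \<delta>"
    by (subst sum.reindex[OF inj]) (simp add: ends_def case_prod_unfold)
  with \<delta> fam have "(\<Sum>(s, t)\<in>ends ` P. norm (g t - g s)) < e1"
    unfolding ac_modulus_def by blast
  then have bad: "(\<Sum>A\<in>P. norm (g (Sup (snd A)) - g (Inf (snd A)))) < e1"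
    by (subst (asm) sum.reindex[OF inj]) (simp add: ends_def case_prod_unfold)
  have good: "g (Sup (snd A)) - g (Inf (snd A)) \<ge> - e2 * (Sup (snd A) - Inf (snd A))"
    if A: "A \<in> p - P" for A
  proof -
    obtain t K where tK: "A = (t, K)" "(t, K) \<in> p" using A by (cases A) auto
    note k = K[OF tK(2)]
    show ?thesis
    proof (cases "t \<in> N")
      case True
      then have "Inf K = Sup K" using A tK k by (auto simp: P_def)
      then show ?thesis by (simp add: tK)
    next
      case False
      have t: "t \<in> {a..b} - N" using False pD(2,3)[OF tK(2)] by blast
      then have "K \<subseteq> ball t (d t)" using k(5) by (simp add: \<gamma>_def)
      moreover have "Inf K \<in> K" "Sup K \<in> K" using k(1-3) by (metis atLeastAtMost_iff order.trans order_refl)+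
      ultimately have "\<bar>Inf K - t\<bar> < d t" "\<bar>Sup K - t\<bar> < d t"
        by (auto simp: dist_real_def abs_minus_commute)
      with d(2)[OF t] k(2,3)
      have "g (Sup K) - g t \<ge> - e2 * (Sup K - t)" "g t - g (Inf K) \<ge> - e2 * (t - Inf K)" by auto
      then show ?thesis by (simp add: tK algebra_simps)
    qed
  qed
  have "- e1 + - (e2 * (b - a)) \<le> - (\<Sum>A\<in>P. norm (g (Sup (snd A)) - g (Inf (snd A))))
      + (\<Sum>A\<in>p - P. - e2 * (Sup (snd A) - Inf (snd A)))"
  proof (rule add_mono)
    have "(\<Sum>A\<in>p - P. Sup (snd A) - Inf (snd A)) \<le> (\<Sum>A\<in>p. Sup (snd A) - Inf (snd A))"
    proof (rule sum_mono2)
      fix A assume "A \<in> p - (p - P)"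
      then show "0 \<le> Sup (snd A) - Inf (snd A)" by (auto simp: P_def)
    qed (use \<open>finite p\<close> in auto)
    also have "\<dots> = b - a"
      using additive_tagged_division_1[OF \<open>a \<le> b\<close> p, of "\<lambda>t. t"] by (simp add: case_prod_unfold)
    finally show "- (e2 * (b - a)) \<le> (\<Sum>A\<in>p - P. - e2 * (Sup (snd A) - Inf (snd A)))"
      using \<open>e2 > 0\<close> by (simp add: sum_distrib_left[symmetric] sum_negf)
  qed (use bad in simp)
  also have "\<dots> \<le> (\<Sum>A\<in>P. g (Sup (snd A)) - g (Inf (snd A)))
      + (\<Sum>A\<in>p - P. g (Sup (snd A)) - g (Inf (snd A)))"
  proof (rule add_mono)
    show "- (\<Sum>A\<in>P. norm (g (Sup (snd A)) - g (Inf (snd A)))) \<le> (\<Sum>A\<in>P. g (Sup (snd A)) - g (Inf (snd A)))"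
      unfolding sum_negf[symmetric] by (rule sum_mono) simp
  qed (rule sum_mono[OF good])
  also have "\<dots> = (\<Sum>A\<in>p. g (Sup (snd A)) - g (Inf (snd A)))"
    unfolding sum.subset_diff[OF \<open>P \<subseteq> p\<close> \<open>finite p\<close>] by (rule add.commute)
  also have "\<dots> = g b - g a"
    using additive_tagged_division_1[OF \<open>a \<le> b\<close> p, of g] by (simp add: case_prod_unfold)
  finally show "g a \<le> g b + e"
    using \<open>e2 * (b - a) \<le> e / 2\<close> by (simp add: e1_def)
qed

section \<open>Operations on solutions of autonomous equations\<close>

lemma AE_lebesgue_shift:
  fixes P :: "real \<Rightarrow> bool"
  assumes "AE t in lebesgue. P t"
  shows "AE t in lebesgue. P (t - s)"
proof -
  obtain N where N: "negligible N" "{t. \<not> P t} \<subseteq> N"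
    using assms unfolding eventually_ae_filter negligible_iff_null_sets by auto
  have "{t. \<not> P (t - s)} \<subseteq> (+) s ` N"
  proof
    fix t assume "t \<in> {t. \<not> P (t - s)}"
    then have "t - s \<in> N" using N(2) by auto
    then show "t \<in> (+) s ` N" by (rule rev_image_eqI) simp
  qed
  then show ?thesis
    using negligible_translation[OF N(1), of s]
    unfolding eventually_ae_filter negligible_iff_null_sets by auto
qed

lemma AE_lebesgue_neq: "AE t in lebesgue. t \<noteq> (c::real)"
proof -
  have "{c} \<in> null_sets lebesgue" using negligible_sing negligible_iff_null_sets by blast
  then show ?thesis unfolding eventually_ae_filter by auto
qed

lemma has_vector_derivative_transform_open_interval:
  fixes a b t :: real
  assumes "(u has_vector_derivative D) (at t)" "t \<in> {a<..<b}" "\<And>s. s \<in> {a<..<b} \<Longrightarrow> u s = v s"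
  shows "(v has_vector_derivative D) (at t)"
  using has_vector_derivative_transform_within_open[OF assms(1) open_greaterThanLessThan assms(2)] assms(3)
  by blast

lemma ode_solution_shift:
  assumes "ode_solution F a b p u"
  shows "ode_solution F (a + s) (b + s) p (\<lambda>t. u (t - s))"
  unfolding ode_solution_def
proof (intro conjI)
  have u: "u a = p" "abs_continuous_on {a..b} u"
    "AE t in lebesgue. t \<in> {a<..<b} \<longrightarrow> (u has_vector_derivative F (u t)) (at t)"
    using assms unfolding ode_solution_def by auto
  show "u (a + s - s) = p" using u by simp
  show "abs_continuous_on {a + s..b + s} (\<lambda>t. u (t - s))"
    by (rule abs_continuous_on_reparam[OF u(2)]) auto
  show "AE t in lebesgue. t \<in> {a + s<..<b + s} \<longrightarrow>
      ((\<lambda>t. u (t - s)) has_vector_derivative F (u (t - s))) (at t)"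
    using AE_lebesgue_shift[OF u(3), of s]
  proof (rule eventually_mono, clarify)
    fix t assume "t - s \<in> {a<..<b} \<longrightarrow> (u has_vector_derivative F (u (t - s))) (at (t - s))"
      and "t \<in> {a + s<..<b + s}"
    then have "(u has_vector_derivative F (u (t - s))) (at (t - s))" by auto
    moreover have "((\<lambda>t. t - s) has_vector_derivative 1) (at t)"
      by (auto intro!: derivative_eq_intros)
    ultimately have "((u \<circ> (\<lambda>t. t - s)) has_vector_derivative 1 *\<^sub>R F (u (t - s))) (at t)"
      by (rule vector_diff_chain_at[rotated])
    then show "((\<lambda>t. u (t - s)) has_vector_derivative F (u (t - s))) (at t)" by (simp add: o_def)
  qed
qed

lemma ode_solution_prefix:
  assumes "ode_solution F a b p u" "c \<le> b"
  shows "ode_solution F a c p u"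
  using assms abs_continuous_on_subset[of "{a..b}" u "{a..c}"]
  unfolding ode_solution_def by (auto elim!: eventually_mono)

text \<open>
  Written as \<open>u (min t b) + (v (max t b) - u b)\<close>, the concatenation is a sum of two reparametrised
  absolutely continuous functions.  The derivative may fail only at the junction \<open>b\<close>, a null set.
\<close>

lemma ode_solution_append:
  assumes u: "ode_solution F a b p u" and v: "ode_solution F b c (u b) v" and "a \<le> b" "b \<le> c"
  shows "ode_solution F a c p (\<lambda>t. if t \<le> b then u t else v t)" (is "ode_solution F a c p ?w")
  unfolding ode_solution_def
proof (intro conjI)
  have v_b: "v b = u b" using v by (simp add: ode_solution_def)
  show "?w a = p" using u \<open>a \<le> b\<close> by (simp add: ode_solution_def)
  have acu: "abs_continuous_on {a..c} (\<lambda>t. u (min t b))"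
    by (rule abs_continuous_on_reparam[of "{a..b}" u])
       (use u \<open>a \<le> b\<close> in \<open>auto simp: ode_solution_def min_def\<close>)
  have acv: "abs_continuous_on {a..c} (\<lambda>t. v (max t b))"
    by (rule abs_continuous_on_reparam[of "{b..c}" v])
       (use v \<open>b \<le> c\<close> in \<open>auto simp: ode_solution_def max_def\<close>)
  show "abs_continuous_on {a..c} ?w"
  proof (rule abs_continuous_on_dominated[OF acu acv])
    fix s t
    have w: "?w t = u (min t b) + (v (max t b) - u b)" for t
      using v_b by (auto simp: min_def max_def)
    have "?w t - ?w s = (u (min t b) - u (min s b)) + (v (max t b) - v (max s b))"
      unfolding w by (simp add: algebra_simps)
    then show "norm (?w t - ?w s) \<le> norm (u (min t b) - u (min s b)) + norm (v (max t b) - v (max s b))"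
      by (metis norm_triangle_ineq)
  qed
  have "AE t in lebesgue. t \<in> {a<..<b} \<longrightarrow> (u has_vector_derivative F (u t)) (at t)"
    and "AE t in lebesgue. t \<in> {b<..<c} \<longrightarrow> (v has_vector_derivative F (v t)) (at t)"
    using u v by (auto simp: ode_solution_def)
  then show "AE t in lebesgue. t \<in> {a<..<c} \<longrightarrow> (?w has_vector_derivative F (?w t)) (at t)"
    using AE_lebesgue_neq[of b]
  proof eventually_elim
    case (elim t)
    show ?case
    proof
      assume t: "t \<in> {a<..<c}"
      consider "t < b" | "b < t" using elim by linarith
      then show "(?w has_vector_derivative F (?w t)) (at t)"
      proof cases
        case 1
        then have "(u has_vector_derivative F (u t)) (at t)" using elim t by auto
        then have "(?w has_vector_derivative F (u t)) (at t)"
          by (rule has_vector_derivative_transform_open_interval[of _ _ _ a b]) (use 1 t in auto)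
        then show ?thesis using 1 by simp
      next
        case 2
        then have "(v has_vector_derivative F (v t)) (at t)" using elim t by auto
        then have "(?w has_vector_derivative F (v t)) (at t)"
          by (rule has_vector_derivative_transform_open_interval[of _ _ _ b c]) (use 2 t in auto)
        then show ?thesis using 2 by simp
      qed
    qed
  qed
qed

lemma ode_solution_close_ends:
  assumes "a < b" and x: "abs_continuous_on {a<..<b} x"
    and der: "AE t in lebesgue. t \<in> {a<..<b} \<longrightarrow> (x has_vector_derivative F (x t)) (at t)"
    and p: "(x \<longlongrightarrow> p) (at_right a)" and q: "(x \<longlongrightarrow> q) (at_left b)"
  shows "ode_solution F a b p (close_ends a b p q x)" (is "ode_solution F a b p ?x")
  unfolding ode_solution_def
proof (intro conjI)
  show "?x a = p" by (simp add: close_ends_def)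
  show "abs_continuous_on {a..b} ?x" by (rule abs_continuous_on_close_ends) fact+
  show "AE t in lebesgue. t \<in> {a<..<b} \<longrightarrow> (?x has_vector_derivative F (?x t)) (at t)"
    using der
  proof (rule eventually_mono, intro impI)
    fix t assume t: "t \<in> {a<..<b}" and "t \<in> {a<..<b} \<longrightarrow> (x has_vector_derivative F (x t)) (at t)"
    then have "(x has_vector_derivative F (x t)) (at t)" by blast
    then have "(?x has_vector_derivative F (x t)) (at t)"
      by (rule has_vector_derivative_transform_open_interval[OF _ t]) (auto simp: close_ends_def)
    then show "(?x has_vector_derivative F (?x t)) (at t)" using t by (simp add: close_ends_def)
  qed
qed

section \<open>States equipped with a clock\<close>

lemma state_part_concat_vec [simp]: "state_part (concat_vec a s) = a"
  by (simp add: state_part_def concat_vec_def vec_eq_iff)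

lemma clock_concat_vec [simp]: "concat_vec a s $ Inr () = s"
  by (simp add: concat_vec_def)

lemma R_mat_mult: "R_mat *v y = state_part y"
proof -
  have "(R_mat *v y) $ i = state_part y $ i" for i
  proof -
    have "(R_mat *v y) $ i = (\<Sum>j\<in>UNIV. R_mat $ i $ j * y $ j)"
      by (simp add: matrix_vector_mult_def)
    also have "\<dots> = (\<Sum>j\<in>UNIV <+> UNIV. R_mat $ i $ j * y $ j)"
      by (simp only: UNIV_Plus_UNIV)
    also have "\<dots> = (\<Sum>k\<in>UNIV. mat 1 $ i $ k * y $ Inl k)"
      by (subst sum.Plus) (simp_all add: R_mat_def)
    also have "\<dots> = (\<Sum>k\<in>UNIV. if i = k then y $ Inl k else 0)"
      by (intro sum.cong) (auto simp: mat_def)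
    also have "\<dots> = state_part y $ i" by (simp add: state_part_def)
    finally show ?thesis .
  qed
  then show ?thesis by (simp add: vec_eq_iff)
qed

lemma norm_concat_vec_le: "norm (concat_vec a s) \<le> norm a + norm s"
proof -
  have "norm (concat_vec a s) ^ 2 = norm a ^ 2 + norm s ^ 2"
    unfolding power2_norm_eq_inner inner_vec_def UNIV_Plus_UNIV[symmetric]
    by (simp add: sum.Plus concat_vec_def UNIV_unit)
  also have "\<dots> \<le> (norm a + norm s) ^ 2"
    by (simp add: power2_sum)
  finally show ?thesis by (rule power2_le_imp_le) simp
qed

lemma concat_vec_diff: "concat_vec a s - concat_vec b r = concat_vec (a - b) (s - r)"
  by (simp add: concat_vec_def vec_eq_iff split: sum.split)

lemma bounded_linear_concat_vec: "bounded_linear (\<lambda>p. concat_vec (fst p) (snd p))"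
proof (rule linear_conv_bounded_linear[THEN iffD1], rule linearI)
qed (auto simp: concat_vec_def vec_eq_iff split: sum.split)

lemma has_vector_derivative_concat_vec:
  assumes "(u has_vector_derivative D) (at t)" "(s has_vector_derivative r) (at t)"
  shows "((\<lambda>t. concat_vec (u t) (s t)) has_vector_derivative concat_vec D r) (at t)"
  using bounded_linear.has_vector_derivative
    [OF bounded_linear_concat_vec has_vector_derivative_Pair[OF assms]] by simp

text \<open>
  Lifts a solution in the original state space to the space with a clock of constant rate \<open>r\<close>.  It is
  used with rate 1 for motion in the feasible region and with rate 0 for the auxiliary dynamics, the
  two branches of the time-frozen field.
\<close>

lemma ode_solution_concat_vec:
  assumes u: "ode_solution f a b p u"
    and s: "abs_continuous_on {a..b} s" "\<And>t. t \<in> {a<..<b} \<Longrightarrow> (s has_vector_derivative r) (at t)"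
    and F: "\<And>t. t \<in> {a<..<b} \<Longrightarrow> F (concat_vec (u t) (s t)) = concat_vec (f (u t)) r"
  shows "ode_solution F a b (concat_vec p (s a)) (\<lambda>t. concat_vec (u t) (s t))"
  unfolding ode_solution_def
proof (intro conjI)
  show "concat_vec (u a) (s a) = concat_vec p (s a)" using u by (simp add: ode_solution_def)
  have "abs_continuous_on {a..b} u" using u by (simp add: ode_solution_def)
  then show "abs_continuous_on {a..b} (\<lambda>t. concat_vec (u t) (s t))"
    by (rule abs_continuous_on_dominated[OF _ s(1)])
       (simp only: concat_vec_diff norm_concat_vec_le)
  have "AE t in lebesgue. t \<in> {a<..<b} \<longrightarrow> (u has_vector_derivative f (u t)) (at t)"
    using u by (simp add: ode_solution_def)
  then show "AE t in lebesgue. t \<in> {a<..<b} \<longrightarrow>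
      ((\<lambda>t. concat_vec (u t) (s t)) has_vector_derivative F (concat_vec (u t) (s t))) (at t)"
  proof (rule eventually_mono, intro impI)
    fix t assume t: "t \<in> {a<..<b}" and "t \<in> {a<..<b} \<longrightarrow> (u has_vector_derivative f (u t)) (at t)"
    then have "(u has_vector_derivative f (u t)) (at t)" by blast
    from has_vector_derivative_concat_vec[OF this s(2)[OF t]]
    show "((\<lambda>t. concat_vec (u t) (s t)) has_vector_derivative F (concat_vec (u t) (s t))) (at t)"
      unfolding F[OF t] .
  qed
qed

text \<open>
  On both branches of the time-frozen field the clock component is nonnegative.
\<close>

lemma clock_mono:
  assumes y: "ode_solution (time_frozen_field f \<psi> \<phi>) a b p y" and "a \<le> s" "s \<le> t" "t \<le> b"
  shows "y s $ Inr () \<le> y t $ Inr ()"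
proof (rule abs_continuous_mono_of_deriv_nonneg[OF \<open>s \<le> t\<close>])
  have "abs_continuous_on {a..b} y" using y by (simp add: ode_solution_def)
  then have "abs_continuous_on {s..t} y"
    by (rule abs_continuous_on_subset) (use assms in auto)
  then show "abs_continuous_on {s..t} (\<lambda>r. y r $ Inr ())"
  proof (rule abs_continuous_on_dominated[OF _ abs_continuous_on_const[of _ "0::real"]])
    show "norm (y r' $ Inr () - y r $ Inr ()) \<le> norm (y r' - y r) + norm (0 - 0 :: real)" for r r'
      using component_le_norm_cart[of "y r' - y r" "Inr ()"] by simp
  qed
  have "AE r in lebesgue. r \<in> {a<..<b} \<longrightarrow>
      (y has_vector_derivative time_frozen_field f \<psi> \<phi> (y r)) (at r)"
    using y by (simp add: ode_solution_def)
  then show "AE r in lebesgue. r \<in> {s<..<t} \<longrightarrow>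
      (\<exists>D\<ge>0. ((\<lambda>r. y r $ Inr ()) has_real_derivative D) (at r))"
  proof (rule eventually_mono, intro impI)
    fix r assume "r \<in> {a<..<b} \<longrightarrow> (y has_vector_derivative time_frozen_field f \<psi> \<phi> (y r)) (at r)"
      and "r \<in> {s<..<t}"
    then have "(y has_vector_derivative time_frozen_field f \<psi> \<phi> (y r)) (at r)" using assms by auto
    then have "((\<lambda>r. y r $ Inr ()) has_real_derivative time_frozen_field f \<psi> \<phi> (y r) $ Inr ()) (at r)"
      unfolding has_real_derivative_iff_has_vector_derivative
      by (rule bounded_linear.has_vector_derivative[OF bounded_linear_vec_nth])
    moreover have "time_frozen_field f \<psi> \<phi> (y r) $ Inr () \<ge> 0"
      by (simp add: time_frozen_field_def)
    ultimately show "\<exists>D\<ge>0. ((\<lambda>r. y r $ Inr ()) has_real_derivative D) (at r)" by blast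
  qed
qed

section \<open>Time-frozen runs that follow a jump solution\<close>

text \<open>
  A solution of the time-frozen equation from \<open>p\<close> at pseudo-time \<open>a\<close> to \<open>q\<close> at pseudo-time \<open>b\<close> whose
  state agrees with \<open>x\<close> at the time shown by the clock.  Clock readings that are jump times or lie
  outside \<open>{0<..<T}\<close> are exempt: while the state moves along an auxiliary arc, the clock stands still at
  a jump time or at 0.
\<close>

definition tracking_run ::
  "(real ^ 'n \<Rightarrow> real ^ 'n) \<Rightarrow> (real ^ 'n \<Rightarrow> real) \<Rightarrow> (real ^ 'n \<Rightarrow> real ^ 'n) \<Rightarrow>
   real \<Rightarrow> (real \<Rightarrow> real ^ 'n) \<Rightarrow> real \<Rightarrow> real \<Rightarrow> real ^ ('n + unit) \<Rightarrow> real ^ ('n + unit) \<Rightarrow>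
   (real \<Rightarrow> real ^ ('n + unit)) \<Rightarrow> bool" where
  "tracking_run f \<psi> \<phi> T x a b p q w \<longleftrightarrow>
     a \<le> b \<and> ode_solution (time_frozen_field f \<psi> \<phi>) a b p w \<and> w b = q \<and>
     (\<forall>\<tau>\<in>{a..b}. w \<tau> $ Inr () \<in> {0<..<T} \<and> \<not> jump_time f \<psi> x (w \<tau> $ Inr ()) \<longrightarrow>
        state_part (w \<tau>) = x (w \<tau> $ Inr ()))"

lemma tracking_run_append:
  assumes u: "tracking_run f \<psi> \<phi> T x a b p q u" and v: "tracking_run f \<psi> \<phi> T x b c q r v"
  shows "\<exists>w. tracking_run f \<psi> \<phi> T x a c p r w"
proof -
  let ?F = "time_frozen_field f \<psi> \<phi>"
  let ?w = "\<lambda>\<tau>. if \<tau> \<le> b then u \<tau> else v \<tau>"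
  let ?P = "\<lambda>z. z $ Inr () \<in> {0<..<T} \<and> \<not> jump_time f \<psi> x (z $ Inr ()) \<longrightarrow>
    state_part z = x (z $ Inr ())"
  have ab: "a \<le> b" and u_sol: "ode_solution ?F a b p u" and u_b: "u b = q"
    and u_track: "\<forall>\<tau>\<in>{a..b}. ?P (u \<tau>)"
    using u unfolding tracking_run_def by blast+
  have bc: "b \<le> c" and v_sol: "ode_solution ?F b c q v" and v_c: "v c = r"
    and v_track: "\<forall>\<tau>\<in>{b..c}. ?P (v \<tau>)"
    using v unfolding tracking_run_def by blast+
  have v_b: "v b = q" using v_sol by (simp add: ode_solution_def)
  have "tracking_run f \<psi> \<phi> T x a c p r ?w"
    unfolding tracking_run_def
  proof (intro conjI ballI)
    show "a \<le> c" using ab bc by simp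
    show "ode_solution ?F a c p ?w"
      using ode_solution_append[OF u_sol _ ab bc] v_sol u_b by simp
    show "?w c = r" using v_b v_c u_b bc by (cases "c = b") auto
    fix \<tau> assume "\<tau> \<in> {a..c}"
    then show "?P (?w \<tau>)"
      using bspec[OF u_track, of \<tau>] bspec[OF v_track, of \<tau>] by (cases "\<tau> \<le> b") simp_all
  qed
  then show ?thesis by blast
qed

text \<open>
  Between jumps a jump solution stays in the feasible region, where the time-frozen field is
  \<open>(f, 1)\<close>: closing its ends and letting the clock run gives a solution.  The hypotheses on \<open>a\<close> and
  \<open>b\<close> ensure that the closed-up function differs from \<open>x\<close> at most at clock readings that are exempt.
\<close>

lemma tracking_run_flight:
  assumes sol: "jump_solution f \<psi> \<Gamma> T x0 x"
    and ab: "0 \<le> a" "a < b" "b \<le> T"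
    and no_jump: "\<And>t. t \<in> {a<..<b} \<Longrightarrow> \<not> jump_time f \<psi> x t"
    and p: "(x \<longlongrightarrow> p) (at_right a)" and q: "(x \<longlongrightarrow> q) (at_left b)"
    and a: "a = 0 \<or> jump_time f \<psi> x a" and b: "jump_time f \<psi> x b \<or> q = x b"
  shows "\<exists>w. tracking_run f \<psi> \<phi> T x r (r + (b - a)) (concat_vec p a) (concat_vec q b) w"
proof -
  let ?F = "time_frozen_field f \<psi> \<phi>"
  let ?x = "close_ends a b p q x"
  let ?w = "\<lambda>t. concat_vec (?x t) t"
  have "{a<..<b} \<subseteq> {0<..<T}" using ab by auto
  then have x: "abs_continuous_on {a<..<b} x"
    "AE t in lebesgue. t \<in> {a<..<b} \<longrightarrow> (x has_vector_derivative f (x t)) (at t)"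
    using sol ab no_jump unfolding jump_solution_def by blast+
  have V: "\<psi> (x t) \<ge> 0" if "t \<in> {a<..<b}" for t
    using sol that ab unfolding jump_solution_def V_pos_def by auto
  have "ode_solution ?F a b (concat_vec p a) ?w"
  proof (rule ode_solution_concat_vec[where s = "\<lambda>t. t" and r = 1])
    show "ode_solution f a b p ?x" by (rule ode_solution_close_ends[OF \<open>a < b\<close> x p q])
    show "((\<lambda>t. t) has_vector_derivative 1) (at t)" for t :: real
      by (auto intro!: derivative_eq_intros)
    show "?F (concat_vec (?x t) t) = concat_vec (f (?x t)) 1" if "t \<in> {a<..<b}" for t
      using V[OF that] that by (simp add: time_frozen_field_def close_ends_def)
  qed (rule abs_continuous_on_ident)
  then have "ode_solution ?F (a + (r - a)) (b + (r - a)) (concat_vec p a) (\<lambda>\<tau>. ?w (\<tau> - (r - a)))"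
    by (rule ode_solution_shift)
  then have "ode_solution ?F r (r + (b - a)) (concat_vec p a) (\<lambda>\<tau>. ?w (\<tau> - (r - a)))"
    by (simp add: algebra_simps)
  moreover have track: "?x t = x t" if "t \<in> {a..b}" "t \<in> {0<..<T}" "\<not> jump_time f \<psi> x t" for t
    using that a b \<open>a < b\<close> by (cases "t = b") (auto simp: close_ends_def)
  ultimately have "tracking_run f \<psi> \<phi> T x r (r + (b - a)) (concat_vec p a) (concat_vec q b)
      (\<lambda>\<tau>. ?w (\<tau> - (r - a)))"
    unfolding tracking_run_def
  proof (intro conjI ballI impI)
    fix \<tau> assume "\<tau> \<in> {r..r + (b - a)}"
      and "?w (\<tau> - (r - a)) $ Inr () \<in> {0<..<T} \<and> \<not> jump_time f \<psi> x (?w (\<tau> - (r - a)) $ Inr ())"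
    then show "state_part (?w (\<tau> - (r - a))) = x (?w (\<tau> - (r - a)) $ Inr ())"
      using track[of "\<tau> - (r - a)"] by auto
  next
    show "?w (r + (b - a) - (r - a)) = concat_vec q b" using \<open>a < b\<close> by (simp add: close_ends_def)
  qed (use \<open>a < b\<close> in auto)
  then show ?thesis by blast
qed

text \<open>
  The auxiliary arc realises the restitution law while the clock stands still at the exempt reading
  \<open>t\<close>.  The case of a nonpositive reading serves an initial value that lies in \<open>S_neg f \<psi>\<close>.
\<close>

lemma tracking_run_impact:
  assumes aux: "auxiliary_dynamics f \<psi> \<Gamma> \<phi>" and l: "l \<in> S_neg f \<psi>"
    and t: "t \<le> 0 \<or> jump_time f \<psi> x t"
  shows "\<exists>r' w. tracking_run f \<psi> \<phi> T x r r' (concat_vec l t) (concat_vec (\<Gamma> l) t) w"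
proof -
  let ?F = "time_frozen_field f \<psi> \<phi>"
  have "\<exists>r'>r. \<exists>u. unique_ode_solution \<phi> r r' l u \<and> (\<forall>\<tau>\<in>{r<..<r'}. u \<tau> \<in> V_neg \<psi>) \<and>
      u r' \<in> S_pos f \<psi> \<and> u r' = \<Gamma> (u r)"
    using bspec[OF spec[OF aux[unfolded auxiliary_dynamics_def], of r] l] .
  then obtain r' u where "r < r'" and sol: "unique_ode_solution \<phi> r r' l u"
    and V: "\<forall>\<tau>\<in>{r<..<r'}. u \<tau> \<in> V_neg \<psi>" and end_state: "u r' = \<Gamma> (u r)"
    by (elim exE conjE)
  have u: "ode_solution \<phi> r r' l u" using sol by (simp add: unique_ode_solution_def)
  have "ode_solution ?F r r' (concat_vec l t) (\<lambda>\<tau>. concat_vec (u \<tau>) t)"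
  proof (rule ode_solution_concat_vec[where s = "\<lambda>_. t" and r = 0])
    show "ode_solution \<phi> r r' l u" by (rule u)
    show "?F (concat_vec (u \<tau>) t) = concat_vec (\<phi> (u \<tau>)) 0" if "\<tau> \<in> {r<..<r'}" for \<tau>
      using bspec[OF V that] by (simp add: time_frozen_field_def V_neg_def)
    show "abs_continuous_on {r..r'} (\<lambda>_. t)" by (rule abs_continuous_on_const)
    show "((\<lambda>_. t) has_vector_derivative 0) (at \<tau>)" for \<tau>
      by (rule has_vector_derivative_const)
  qed
  moreover have "u r = l" using u by (simp add: ode_solution_def)
  ultimately have "tracking_run f \<psi> \<phi> T x r r' (concat_vec l t) (concat_vec (\<Gamma> l) t)
      (\<lambda>\<tau>. concat_vec (u \<tau>) t)"
    using t \<open>r < r'\<close> end_state by (auto simp: tracking_run_def)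
  then show ?thesis by blast
qed

text \<open>
  The pieces are: an auxiliary arc if \<open>x0\<close> requires an immediate jump, a flight to the jump time if
  there is one, the auxiliary arc of that jump, and a flight to \<open>c\<close>.  Stopping at \<open>c < T\<close> makes \<open>x\<close>
  continuous at the end of the last flight, whereas nothing prescribes a value of \<open>x\<close> at \<open>T\<close>.
\<close>

lemma tracking_run_to:
  assumes aux: "auxiliary_dynamics f \<psi> \<Gamma> \<phi>"
    and sol: "jump_solution f \<psi> \<Gamma> T x0 x"
    and jumps: "\<And>s t. s \<in> {0<..<T} \<Longrightarrow> t \<in> {0<..<T} \<Longrightarrow> jump_time f \<psi> x s \<Longrightarrow> jump_time f \<psi> x t \<Longrightarrow> s = t"
    and c: "c \<in> {0<..<T}" "\<And>t. t \<in> {c..<T} \<Longrightarrow> \<not> jump_time f \<psi> x t"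
  shows "\<exists>L w. tracking_run f \<psi> \<phi> T x 0 L (concat_vec x0 0) (concat_vec (x c) c) w"
proof -
  let ?run = "tracking_run f \<psi> \<phi> T x"
  have left_c: "(x \<longlongrightarrow> x c) (at_left c)"
  proof -
    have "isCont x c" using sol c by (simp add: jump_solution_def)
    then show ?thesis unfolding isCont_def by (rule tendsto_within_subset) simp
  qed
  define p where "p = (if x0 \<in> S_neg f \<psi> then \<Gamma> x0 else x0)"
  have right_0: "(x \<longlongrightarrow> p) (at_right 0)" using sol unfolding jump_solution_def p_def by blast
  obtain L0 w0 where w0: "?run 0 L0 (concat_vec x0 0) (concat_vec p 0) w0"
  proof (cases "x0 \<in> S_neg f \<psi>")
    case True
    then show thesis using tracking_run_impact[OF aux True, of 0 x T 0] that by (auto simp: p_def)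
  next
    case False
    have "?run 0 0 (concat_vec x0 0) (concat_vec p 0) (\<lambda>_. concat_vec x0 0)"
      using False by (simp add: tracking_run_def p_def ode_solution_def abs_continuous_on_const)
    then show thesis by (rule that)
  qed
  show ?thesis
  proof (cases "\<exists>ts\<in>{0<..<T}. jump_time f \<psi> x ts")
    case False
    then obtain w1 where "?run L0 (L0 + (c - 0)) (concat_vec p 0) (concat_vec (x c) c) w1"
      using tracking_run_flight[OF sol _ _ _ _ right_0 left_c, of \<phi> L0] c by fastforce
    then show ?thesis using tracking_run_append[OF w0] by blast
  next
    case True
    then obtain ts where ts: "ts \<in> {0<..<T}" "jump_time f \<psi> x ts" by blast
    have "ts < c"
    proof (rule ccontr)
      assume "\<not> ts < c"
      then show False using c(2)[of ts] ts by simp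
    qed
    obtain l where l: "l \<in> S_neg f \<psi>" "(x \<longlongrightarrow> l) (at_left ts)"
      using ts(2) by (auto simp: jump_time_def)
    have right_ts: "(x \<longlongrightarrow> \<Gamma> l) (at_right ts)"
      using sol ts(1) l unfolding jump_solution_def by blast
    have only: "\<not> jump_time f \<psi> x t" if "t \<in> {0<..<T}" "t \<noteq> ts" for t
      using jumps[OF that(1) ts(1)] ts(2) that(2) by blast
    obtain w1 where "?run L0 (L0 + (ts - 0)) (concat_vec p 0) (concat_vec l ts) w1"
      using tracking_run_flight[OF sol _ _ _ _ right_0 l(2), of \<phi> L0] ts only by fastforce
    then obtain w2 where "?run 0 (L0 + (ts - 0)) (concat_vec x0 0) (concat_vec l ts) w2"
      using tracking_run_append[OF w0] by blast
    moreover obtain L3 w3 where "?run (L0 + (ts - 0)) L3 (concat_vec l ts) (concat_vec (\<Gamma> l) ts) w3"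
      using tracking_run_impact[OF aux l(1)] ts(2) by blast
    ultimately obtain w4 where w4: "?run 0 L3 (concat_vec x0 0) (concat_vec (\<Gamma> l) ts) w4"
      using tracking_run_append by blast
    obtain w5 where "?run L3 (L3 + (c - ts)) (concat_vec (\<Gamma> l) ts) (concat_vec (x c) c) w5"
      using tracking_run_flight[OF sol _ \<open>ts < c\<close> _ _ right_ts left_c, of \<phi> L3] ts c(1) only by fastforce
    then show ?thesis using tracking_run_append[OF w4] by blast
  qed
qed

section \<open>Equivalence of the two formulations\<close>

theorem theorem1:
  fixes f \<phi> \<Gamma> :: "real ^ 'n \<Rightarrow> real ^ 'n"
    and \<psi> :: "real ^ 'n \<Rightarrow> real"
    and x0 :: "real ^ 'n"
    and y :: "real \<Rightarrow> real ^ ('n + unit)"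
    and x xt :: "real \<Rightarrow> real ^ 'n"
    and clock :: "real \<Rightarrow> real"
    and \<tau>f tf :: real
  assumes "\<forall>z. \<psi> differentiable (at z)"
    and "\<Gamma> \<in> S_neg f \<psi> \<rightarrow> S_pos f \<psi>"
    and "auxiliary_dynamics f \<psi> \<Gamma> \<phi>"
    and "x0 \<in> V_pos \<psi>"
    and "\<tau>f > 0"
    and "unique_ode_solution (time_frozen_field f \<psi> \<phi>) 0 \<tau>f (concat_vec x0 0) y"
    and "\<forall>\<tau>\<in>{0..\<tau>f}. y \<tau> = concat_vec (xt \<tau>) (clock \<tau>)"
    and "xt \<tau>f \<in> V_pos \<psi>"
    and "tf = clock \<tau>f"
    and "unique_jump_solution f \<psi> \<Gamma> tf x0 x"
    and "\<exists>\<^sub>\<le>\<^sub>1 ts. ts \<in> {0<..<tf} \<and> \<psi> (x ts) = 0"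
  shows "\<forall>\<tau>\<in>{0<..<\<tau>f}.
           clock \<tau> \<in> {0<..<tf} \<and> (\<forall>ts\<in>{0<..<tf}. \<psi> (x ts) = 0 \<longrightarrow> clock \<tau> \<noteq> ts) \<longrightarrow>
           x (clock \<tau>) = R_mat *v y \<tau>"
proof (intro ballI impI, elim conjE)
  fix \<tau> assume \<tau>: "\<tau> \<in> {0<..<\<tau>f}" and clock_\<tau>: "clock \<tau> \<in> {0<..<tf}"
    and off_S: "\<forall>ts\<in>{0<..<tf}. \<psi> (x ts) = 0 \<longrightarrow> clock \<tau> \<noteq> ts"
  have sol: "jump_solution f \<psi> \<Gamma> tf x0 x" using assms(10) by (simp add: unique_jump_solution_def)
  have jump_S: "\<psi> (x t) = 0" if "t \<in> {0<..<tf}" "jump_time f \<psi> x t" for t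
    using sol that unfolding jump_solution_def jump_time_def by blast
  have jump_unique: "s = t"
    if "s \<in> {0<..<tf}" "t \<in> {0<..<tf}" "jump_time f \<psi> x s" "jump_time f \<psi> x t" for s t
    using Uniq_D[OF assms(11)] jump_S that by blast
  \<comment> \<open>A stopping time later than both \<open>clock \<tau>\<close> and the jump, so that the run built up to \<open>c\<close> covers \<open>\<tau>\<close>.\<close>
  obtain c where c: "clock \<tau> < c" "c < tf" "\<And>t. t \<in> {c..<tf} \<Longrightarrow> \<not> jump_time f \<psi> x t"
  proof (cases "\<exists>ts\<in>{0<..<tf}. jump_time f \<psi> x ts")
    case True
    then obtain ts where ts: "ts \<in> {0<..<tf}" "jump_time f \<psi> x ts" by blast
    with clock_\<tau> obtain c where c: "max (clock \<tau>) ts < c" "c < tf" using dense[of "max (clock \<tau>) ts" tf] by auto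
    show thesis
    proof (rule that[of c])
      fix t assume "t \<in> {c..<tf}"
      then have "t \<in> {0<..<tf}" "t \<noteq> ts" using c ts(1) by auto
      then show "\<not> jump_time f \<psi> x t" using jump_unique ts by blast
    qed (use c in auto)
  next
    case False
    obtain c where c: "clock \<tau> < c" "c < tf" using clock_\<tau> dense[of "clock \<tau>" tf] by auto
    show thesis
    proof (rule that[OF c])
      fix t assume "t \<in> {c..<tf}"
      then have "t \<in> {0<..<tf}" using c clock_\<tau> by auto
      then show "\<not> jump_time f \<psi> x t" using False by blast
    qed
  qed
  have c_in: "c \<in> {0<..<tf}" using c(1,2) clock_\<tau> by simp
  obtain L w where w: "tracking_run f \<psi> \<phi> tf x 0 L (concat_vec x0 0) (concat_vec (x c) c) w"
    using tracking_run_to[OF assms(3) sol jump_unique c_in c(3)] by blast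
  have clock_y: "y r $ Inr () = clock r" if "r \<in> {0..\<tau>f}" for r
    using assms(7) that by simp
  have y_sol: "ode_solution (time_frozen_field f \<psi> \<phi>) 0 \<tau>f (concat_vec x0 0) y"
    using assms(6) by (simp add: unique_ode_solution_def)
  have w_sol: "ode_solution (time_frozen_field f \<psi> \<phi>) 0 L (concat_vec x0 0) w"
    and w_L: "w L = concat_vec (x c) c" and "0 \<le> L"
    using w by (auto simp: tracking_run_def)
  have "L \<noteq> 0"
  proof
    assume "L = 0"
    then have "concat_vec (x c) c = concat_vec x0 0" using w_sol w_L by (simp add: ode_solution_def)
    then have "c = 0" by (metis clock_concat_vec)
    then show False using c(1) clock_\<tau> by simp
  qed
  then have "0 < min L \<tau>f" "min L \<tau>f \<le> \<tau>f" using \<open>0 \<le> L\<close> \<open>\<tau>f > 0\<close> by simp_all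
  moreover have "ode_solution (time_frozen_field f \<psi> \<phi>) 0 (min L \<tau>f) (concat_vec x0 0) w"
    by (rule ode_solution_prefix[OF w_sol]) simp
  ultimately have "\<forall>r\<in>{0..min L \<tau>f}. w r = y r"
    using assms(6) unfolding unique_ode_solution_def by blast
  then have agree: "w r = y r" if "0 \<le> r" "r \<le> L" "r \<le> \<tau>f" for r using that by simp
  \<comment> \<open>Otherwise the clock would already have shown \<open>c\<close> before \<open>\<tau>\<close>, and it never runs backwards.\<close>
  have "\<tau> \<le> L"
  proof (rule ccontr)
    assume "\<not> \<tau> \<le> L"
    then have "y L = w L" using agree[of L] \<tau> \<open>0 \<le> L\<close> by simp
    then have "c = y L $ Inr ()" using w_L by simp
    also have "\<dots> \<le> y \<tau> $ Inr ()"
      using clock_mono[OF y_sol] \<open>\<not> \<tau> \<le> L\<close> \<tau> \<open>0 \<le> L\<close> by simp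
    also have "\<dots> = clock \<tau>" using clock_y \<tau> by simp
    finally show False using c(1) by simp
  qed
  then have w_\<tau>: "w \<tau> = y \<tau>" using agree \<tau> by simp
  have y_\<tau>: "y \<tau> $ Inr () = clock \<tau>" using clock_y \<tau> by simp
  have "\<not> jump_time f \<psi> x (clock \<tau>)" using off_S jump_S clock_\<tau> by blast
  moreover have "\<tau> \<in> {0..L}" using \<open>\<tau> \<le> L\<close> \<tau> by simp
  ultimately have "state_part (w \<tau>) = x (w \<tau> $ Inr ())"
    using w clock_\<tau> unfolding tracking_run_def w_\<tau> y_\<tau>[symmetric]
    by (metis w_\<tau>)
  then have "state_part (y \<tau>) = x (clock \<tau>)" by (simp add: w_\<tau> y_\<tau>)
  then show "x (clock \<tau>) = R_mat *v y \<tau>" by (simp add: R_mat_mult)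
qed

end
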